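(* Let $L=L(x,u,u_1)$ be a regular first order Lagrangian on $J^1(\pi)$, let $u_2^a=f^a(x,u,u_1)$, $a=1,\dots,q$, be its Euler-Lagrange equations, and let $\Theta$ be the Poincaré-Cartan $1$-form of $L$. Let $\lambda=\lambda(x,u,u_1)$ be a smooth function on $J^1(\pi)$ and let $X$ be a (divergence) $\lambda$-variational symmetry for $L$ with divergence term $R$. For a smooth function $A$ of $(x,u,u_1,w)$ put $\tilde X=e^{w}(X+A\,\partial_w)$, and let $I=X\lrcorner\Theta-R$. Then $$\tilde I=\tilde X\lrcorner\Theta-e^{w}R=e^{w}I$$ is a first integral for $\tilde D_x=\partial_x+u_1^a\partial_{u^a}+f^a\partial_{u_1^a}+\lambda\,\partial_w$, i.e. for the covering system $\{u_2^a=f^a(x,u,u_1),\ w_1=\lambda\}$; that is, $\tilde D_x(\tilde I)=0$.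
   Context: Summation over repeated indices is understood. $\pi:M\to B$ is a $q$-dimensional bundle with $\dim B=1$, and $B$, $M$ have local coordinates $x$ and $(x,u^1,\dots,u^q)$. $J^k(\pi)$ is the $k$-th order jet bundle, with coordinates $(x,u^a,u_1^a,\dots,u_k^a)$, and $D_x=\partial_x+u_1^a\partial_{u^a}+u_2^a\partial_{u_1^a}+\cdots$ is the total derivative. $L$ is a regular first order Lagrangian (the matrix $\partial^2L/\partial u_1^a\partial u_1^b$ is nondegenerate). Its Euler-Lagrange equations are written in solved form $\mathcal{E}:\ u_2^a=f^a(x,u,u_1)$, $a=1,\dots,q$. Both $\mathcal{E}\subset J^2(\pi)$ and its infinite prolongation are parametrized by the coordinates $(x,u^a,u_1^a)$, and are thus identified with $J^1(\pi)$. The Poincaré-Cartan $1$-form is $\Theta=\frac{\partial L}{\partial u_1^a}(du^a-u_1^a\,dx)+L\,dx$; its pullback to the covering space (below) is denoted by the same letter. The symbol $\lrcorner$ denotes contraction of a vector field with a form. $\lambda$-prolongation: for a smooth function $\lambda$ on $J^1(\pi)$, the $\lambda$-prolongation of $X_0=\xi\partial_x+\eta^a\partial_{u^a}$ (with $\xi,\eta^a$ smooth functions on $M$) is $X=\xi\partial_x+\eta^a_{[\lambda,i]}\partial_{u^a_i}$ with $\eta^a_{[\lambda,0]}=\eta^a$ and $$\eta^a_{[\lambda,i]}=D_x(\eta^a_{[\lambda,i-1]})-D_x(\xi)u_i^a+\lambda(\eta^a_{[\lambda,i-1]}-\xi u_i^a).$$ Only the first order prolongation $X=\xi\partial_x+\eta^a\partial_{u^a}+\eta^a_{[\lambda,1]}\partial_{u_1^a}$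 on $J^1(\pi)$ is involved here. Definition: $X$ is called a (divergence) $\lambda$-variational symmetry for $L$ (with divergence term $R$) if $X$ is the $\lambda$-prolongation of a vector field $X_0=\xi\partial_x+\eta^a\partial_{u^a}$ on $M$ and $X(L)+L(D_x+\lambda)\xi=(D_x+\lambda)R$ for the function $R$ on $M$; here $(D_x+\lambda)g$ means $D_x(g)+\lambda g$. Covering: the covering space $\tilde{\mathcal{E}}$ is the infinite prolongation of the system $\{u_2^a=f^a(x,u,u_1),\ w_1=\lambda\}$, with one additional dependent variable $w$. It has coordinates $(x,u^a,u_1^a,w)$, and its contact distribution is generated by $\tilde D_x$. A first integral is a smooth function annihilated by $\tilde D_x$. *)

theory Defs
  imports "HOL-Analysis.Analysis"
begin

text \<open>
  Everything is written in a local trivialization of the bundle: the total space is an open set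
  \<open>M\<close> of points \<open>(x, u)\<close>, and the jet spaces and the covering are the corresponding
  (full) coordinate domains over \<open>M\<close>. Tangent spaces are identified with the ambient
  Euclidean space, so a vector field is a vector-valued map and a 1-form is a map
  taking a point and a tangent vector to a real number.
\<close>

type_synonym 'q jet0 = "real \<times> (real, 'q) vec"
type_synonym 'q jet1 = "real \<times> (real, 'q) vec \<times> (real, 'q) vec"
type_synonym 'q jet2 = "real \<times> (real, 'q) vec \<times> (real, 'q) vec \<times> (real, 'q) vec"
type_synonym 'q cov = "real \<times> (real, 'q) vec \<times> (real, 'q) vec \<times> real"

definition J1 :: "('q::finite) jet0 set \<Rightarrow> 'q jet1 set" where
  "J1 M = {(x, u, u1) | x u u1. (x, u) \<in> M}"

definition Cov :: "('q::finite) jet0 set \<Rightarrow> 'q cov set" where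
  "Cov M = {(x, u, u1, w) | x u u1 w. (x, u) \<in> M}"

definition jet1_to_jet0 :: "('q::finite) jet1 \<Rightarrow> 'q jet0" where
  "jet1_to_jet0 = (\<lambda>(x, u, u1). (x, u))"

definition cov_to_jet1 :: "('q::finite) cov \<Rightarrow> 'q jet1" where
  "cov_to_jet1 = (\<lambda>(x, u, u1, w). (x, u, u1))"

definition cov_w :: "('q::finite) cov \<Rightarrow> real" where
  "cov_w = (\<lambda>(x, u, u1, w). w)"


text \<open>Smoothness on an open set: all iterated directional derivatives exist and are continuous.\<close>

fun Ck_on :: "nat \<Rightarrow> ('a::euclidean_space \<Rightarrow> 'b::real_normed_vector) \<Rightarrow> 'a set \<Rightarrow> bool" where
  "Ck_on 0 g S \<longleftrightarrow> continuous_on S g"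
| "Ck_on (Suc k) g S \<longleftrightarrow>
     g differentiable_on S \<and> (\<forall>v. Ck_on k (\<lambda>p. frechet_derivative g (at p) v) S)"

definition smooth_on :: "'a::euclidean_space set \<Rightarrow> ('a \<Rightarrow> 'b::real_normed_vector) \<Rightarrow> bool" where
  "smooth_on S g \<longleftrightarrow> (\<forall>k. Ck_on k g S)"

definition vf_apply ::
    "('a::real_normed_vector \<Rightarrow> 'a) \<Rightarrow> ('a \<Rightarrow> real) \<Rightarrow> 'a \<Rightarrow> real" where
  "vf_apply X g p = frechet_derivative g (at p) (X p)"

definition contract :: "('a \<Rightarrow> 'a) \<Rightarrow> ('a \<Rightarrow> 'a \<Rightarrow> real) \<Rightarrow> 'a \<Rightarrow> real" where
  "contract X \<omega> p = \<omega> p (X p)"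

definition form_pullback ::
    "('a::real_normed_vector \<Rightarrow> 'b::real_normed_vector) \<Rightarrow> ('b \<Rightarrow> 'b \<Rightarrow> real) \<Rightarrow> 'a \<Rightarrow> 'a \<Rightarrow> real" where
  "form_pullback h \<omega> p v = \<omega> (h p) (frechet_derivative h (at p) v)"


definition d_u :: "'q \<Rightarrow> (('q::finite) jet1 \<Rightarrow> real) \<Rightarrow> 'q jet1 \<Rightarrow> real" where
  "d_u a g p = frechet_derivative g (at p) (0, axis a 1, 0)"

definition d_u1 :: "'q \<Rightarrow> (('q::finite) jet1 \<Rightarrow> real) \<Rightarrow> 'q jet1 \<Rightarrow> real" where
  "d_u1 a g p = frechet_derivative g (at p) (0, 0, axis a 1)"

text \<open>
  The total derivative raises the jet order by one. Its restriction to functions on \<open>M\<close> is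
  \<open>\<partial>_x + u1^a \<partial>_u^a\<close>, and its restriction to functions on the first jet space is
  \<open>\<partial>_x + u1^a \<partial>_u^a + u2^a \<partial>_u1^a\<close>.
\<close>

definition Dx0 :: "(('q::finite) jet0 \<Rightarrow> real) \<Rightarrow> 'q jet1 \<Rightarrow> real" where
  "Dx0 g = (\<lambda>(x, u, u1). frechet_derivative g (at (x, u)) (1, u1))"

definition Dx1 :: "(('q::finite) jet1 \<Rightarrow> real) \<Rightarrow> 'q jet2 \<Rightarrow> real" where
  "Dx1 g = (\<lambda>(x, u, u1, u2). frechet_derivative g (at (x, u, u1)) (1, u1, u2))"

definition Dx_plus ::
    "(('q::finite) jet1 \<Rightarrow> real) \<Rightarrow> ('q jet0 \<Rightarrow> real) \<Rightarrow> 'q jet1 \<Rightarrow> real" where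
  "Dx_plus lam g p = Dx0 g p + lam p * g (jet1_to_jet0 p)"


definition regular_lagrangian :: "('q::finite) jet0 set \<Rightarrow> ('q jet1 \<Rightarrow> real) \<Rightarrow> bool" where
  "regular_lagrangian M L \<longleftrightarrow>
     smooth_on (J1 M) L \<and> (\<forall>p\<in>J1 M. det (\<chi> a b. d_u1 a (d_u1 b L) p) \<noteq> 0)"

definition euler_lagrange :: "(('q::finite) jet1 \<Rightarrow> real) \<Rightarrow> 'q \<Rightarrow> 'q jet2 \<Rightarrow> real" where
  "euler_lagrange L a = (\<lambda>(x, u, u1, u2). d_u a L (x, u, u1) - Dx1 (d_u1 a L) (x, u, u1, u2))"

definition euler_lagrange_solved_form ::
    "('q::finite) jet0 set \<Rightarrow> ('q jet1 \<Rightarrow> real) \<Rightarrow> ('q jet1 \<Rightarrow> (real, 'q) vec) \<Rightarrow> bool" where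
  "euler_lagrange_solved_form M L f \<longleftrightarrow>
     (\<forall>x u u1 u2. (x, u) \<in> M \<longrightarrow>
        ((\<forall>a. euler_lagrange L a (x, u, u1, u2) = 0) \<longleftrightarrow> (\<forall>a. u2 $ a = f (x, u, u1) $ a)))"

definition poincare_cartan :: "(('q::finite) jet1 \<Rightarrow> real) \<Rightarrow> 'q jet1 \<Rightarrow> 'q jet1 \<Rightarrow> real" where
  "poincare_cartan L = (\<lambda>(x, u, u1) (dx, du, du1).
     (\<Sum>a\<in>UNIV. d_u1 a L (x, u, u1) * (du $ a - u1 $ a * dx)) + L (x, u, u1) * dx)"


definition lambda_prolongation ::
    "(('q::finite) jet1 \<Rightarrow> real) \<Rightarrow> ('q jet0 \<Rightarrow> 'q jet0) \<Rightarrow> 'q jet1 \<Rightarrow> 'q jet1" where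
  "lambda_prolongation lam X0 = (\<lambda>(x, u, u1).
     let \<xi> = (\<lambda>m. fst (X0 m)); \<eta> = (\<lambda>a m. snd (X0 m) $ a) in
     (\<xi> (x, u), \<chi> a. \<eta> a (x, u),
      \<chi> a. Dx0 (\<eta> a) (x, u, u1) - Dx0 \<xi> (x, u, u1) * u1 $ a
           + lam (x, u, u1) * (\<eta> a (x, u) - \<xi> (x, u) * u1 $ a)))"

definition lambda_variational_symmetry ::
    "('q::finite) jet0 set \<Rightarrow> ('q jet1 \<Rightarrow> real) \<Rightarrow> ('q jet1 \<Rightarrow> real) \<Rightarrow>
     ('q jet1 \<Rightarrow> 'q jet1) \<Rightarrow> ('q jet0 \<Rightarrow> real) \<Rightarrow> bool" where
  "lambda_variational_symmetry M L lam X R \<longleftrightarrow>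
     smooth_on M R \<and>
     (\<exists>X0. smooth_on M X0 \<and>
        (\<forall>p\<in>J1 M. X p = lambda_prolongation lam X0 p) \<and>
        (\<forall>p\<in>J1 M. vf_apply X L p + L p * Dx_plus lam (\<lambda>m. fst (X0 m)) p = Dx_plus lam R p))"


text \<open>
  The total derivative of the covering system \<open>u2 = f\<close>, \<open>w1 = lam\<close>, as a vector field in the
  internal coordinates \<open>(x, u, u1, w)\<close>.
\<close>

definition cov_total_derivative ::
    "(('q::finite) jet1 \<Rightarrow> (real, 'q) vec) \<Rightarrow> ('q jet1 \<Rightarrow> real) \<Rightarrow> 'q cov \<Rightarrow> 'q cov" where
  "cov_total_derivative f lam = (\<lambda>(x, u, u1, w). (1, u1, f (x, u, u1), lam (x, u, u1)))"

definition cov_first_integral ::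
    "('q::finite) jet0 set \<Rightarrow> ('q jet1 \<Rightarrow> (real, 'q) vec) \<Rightarrow> ('q jet1 \<Rightarrow> real) \<Rightarrow> ('q cov \<Rightarrow> real) \<Rightarrow> bool" where
  "cov_first_integral M f lam F \<longleftrightarrow>
     smooth_on (Cov M) F \<and> (\<forall>p\<in>Cov M. vf_apply (cov_total_derivative f lam) F p = 0)"

text \<open>The vector field \<open>e^w (X + A \<partial>_w)\<close>.\<close>

definition cov_lift ::
    "(('q::finite) jet1 \<Rightarrow> 'q jet1) \<Rightarrow> ('q cov \<Rightarrow> real) \<Rightarrow> 'q cov \<Rightarrow> 'q cov" where
  "cov_lift X A p =
     (case X (cov_to_jet1 p) of (\<xi>, \<eta>, \<eta>1) \<Rightarrow> exp (cov_w p) *\<^sub>R (\<xi>, \<eta>, \<eta>1, A p))"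

end

theory Submission
  imports Defs
begin

text \<open>
  Write \<open>Q^a = \<eta>^a - u1^a \<xi>\<close> for the characteristic of the vector field \<open>X0\<close>, so that
  \<open>I = L_{u1^a} Q^a + L \<xi> - R\<close>. Differentiating \<open>I\<close> totally and integrating by parts, as in
  Noether's theorem, gives for every second derivative \<open>u2\<close>, and for every \<open>lam\<close>,

    \<open>D_x I = - E_a(L) Q^a + (X(L) + L (D_x + lam) \<xi> - (D_x + lam) R) - lam I\<close>,

  where \<open>X\<close> is the \<open>lam\<close>-prolongation of \<open>X0\<close> and \<open>E_a(L)\<close> are the Euler-Lagrange
  expressions (\<open>lambda_noether_identity\<close>). For \<open>lam = 0\<close> this is the classical identity; in
  general the prolongation adds \<open>lam Q^a\<close> to the \<open>u1^a\<close>-component, hence \<open>lam L_{u1^a} Q^a\<close> to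
  \<open>X(L)\<close>, and together with the terms \<open>lam L \<xi>\<close> and \<open>- lam R\<close> of the symmetry condition this
  is exactly \<open>lam I\<close>.

  Along \<open>u2 = f\<close> the Euler-Lagrange expressions vanish, and the bracket vanishes for a
  \<open>lam\<close>-variational symmetry. So \<open>D_x I = - lam I\<close> on solutions: \<open>I\<close> is not conserved but
  obeys a homogeneous linear equation. The variable \<open>w\<close> with \<open>w1 = lam\<close> supplies the integrating factor
  \<open>e^w\<close>, which makes \<open>e^w I\<close> a first integral (\<open>cov_first_integral_exp_w\<close>). The contraction of
  \<open>e^w (X + A \<partial>_w)\<close> with \<open>\<Theta>\<close> is \<open>e^w\<close> times that of \<open>X\<close> because the pullback of \<open>\<Theta>\<close> has
  no \<open>dw\<close> part (\<open>contract_cov_lift_pullback\<close>).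

  A first integral has to be smooth on the covering, so the algebra of smooth functions is
  developed for the directional-derivative definition of smoothness.
\<close>

section \<open>Smooth functions on open sets\<close>

lemma frechet_derivative_eqI:
  "(g has_derivative g') (at p) \<Longrightarrow> frechet_derivative g (at p) = g'"
  using frechet_derivative_at by metis

lemma differentiable_on_has_derivative:
  assumes "g differentiable_on S" "open S" "p \<in> S"
  shows "(g has_derivative frechet_derivative g (at p)) (at p)"
  using assms at_within_open frechet_derivative_works
  unfolding differentiable_on_def by metis

lemma has_derivative_differentiable_on:
  "(\<And>p. p \<in> S \<Longrightarrow> (g has_derivative g' p) (at p)) \<Longrightarrow> g differentiable_on S"
  unfolding differentiable_on_def
  by (meson differentiableI has_derivative_at_withinI)

lemma Ck_on_cong:
  assumes "open S" "\<And>p. p \<in> S \<Longrightarrow> f p = g p"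
  shows "Ck_on k f S \<longleftrightarrow> Ck_on k g S"
  using assms(2)
proof (induction k arbitrary: f g)
  case 0
  then show ?case using continuous_on_cong[OF refl, of S f g] by simp
next
  case (Suc k)
  have same: "(f has_derivative h) (at p) \<longleftrightarrow> (g has_derivative h) (at p)" if "p \<in> S" for p h
  proof
    show "(g has_derivative h) (at p)" if "(f has_derivative h) (at p)"
      using that assms(1) \<open>p \<in> S\<close> Suc.prems by (rule has_derivative_transform_within_open)
    show "(f has_derivative h) (at p)" if "(g has_derivative h) (at p)"
      using that assms(1) \<open>p \<in> S\<close> Suc.prems[symmetric]
      by (rule has_derivative_transform_within_open)
  qed
  then have diff_on: "f differentiable_on S \<longleftrightarrow> g differentiable_on S"
    unfolding differentiable_on_def differentiable_def
    using at_within_open[OF _ assms(1)] by (metis (no_types, lifting))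
  have "frechet_derivative f (at p) = frechet_derivative g (at p)" if "p \<in> S" for p
    unfolding frechet_derivative_def same[OF that] ..
  then have "Ck_on k (\<lambda>p. frechet_derivative f (at p) v) S
      \<longleftrightarrow> Ck_on k (\<lambda>p. frechet_derivative g (at p) v) S" for v
    by (intro Suc.IH) simp
  then show ?case using diff_on by simp
qed

text \<open>
  The recursive definition of \<open>Ck_on\<close> speaks of the chosen derivative \<open>frechet_derivative\<close>; this
  rule lets an induction on the order work with any explicit formula for the derivative.
\<close>

lemma Ck_on_SucI:
  assumes "open S"
    and "\<And>p. p \<in> S \<Longrightarrow> (g has_derivative g' p) (at p)"
    and "\<And>v. Ck_on k (\<lambda>p. g' p v) S"
  shows "Ck_on (Suc k) g S"
proof -
  have "Ck_on k (\<lambda>p. frechet_derivative g (at p) v) S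
      \<longleftrightarrow> Ck_on k (\<lambda>p. g' p v) S" for v
    using frechet_derivative_eqI[OF assms(2)]
    by (intro Ck_on_cong[OF assms(1)]) simp
  then show ?thesis
    using assms(3) has_derivative_differentiable_on[OF assms(2)] by simp
qed

lemma Ck_on_Suc_has_derivative:
  "Ck_on (Suc k) g S \<Longrightarrow> open S \<Longrightarrow> p \<in> S
    \<Longrightarrow> (g has_derivative frechet_derivative g (at p)) (at p)"
  using differentiable_on_has_derivative Ck_on.simps(2) by blast

text \<open>
  In the product rule the undifferentiated factor keeps its order, so the induction for products
  has to lower it by one.
\<close>

lemma Ck_on_Suc_imp: "Ck_on (Suc k) g S \<Longrightarrow> Ck_on k g S"
proof (induction k arbitrary: g)
  case 0
  then show ?case by (simp add: differentiable_imp_continuous_on)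
next
  case (Suc k)
  have "Ck_on k (\<lambda>p. frechet_derivative g (at p) v) S" for v
    using Suc.prems Suc.IH Ck_on.simps(2) by metis
  then show ?case using Suc.prems by simp
qed

lemma Ck_on_const: "open S \<Longrightarrow> Ck_on k (\<lambda>p. c) S"
proof (induction k arbitrary: c)
  case (Suc k)
  show ?case
    using Suc by (intro Ck_on_SucI[where g' = "\<lambda>_ _. 0"]) auto
qed simp

lemma Ck_on_add:
  assumes "open S" "Ck_on k f S" "Ck_on k g S"
  shows "Ck_on k (\<lambda>p. f p + g p) S"
  using assms(2,3)
proof (induction k arbitrary: f g)
  case 0
  then show ?case by (simp add: continuous_on_add)
next
  case (Suc k)
  show ?case
  proof (rule Ck_on_SucI[OF assms(1)])
    show "((\<lambda>p. f p + g p) has_derivative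
        (\<lambda>v. frechet_derivative f (at p) v + frechet_derivative g (at p) v)) (at p)"
      if "p \<in> S" for p
      using that Suc.prems assms(1) by (intro has_derivative_add Ck_on_Suc_has_derivative)
    show "Ck_on k (\<lambda>p. frechet_derivative f (at p) v + frechet_derivative g (at p) v) S" for v
      using Suc.prems by (intro Suc.IH) auto
  qed
qed

lemma Ck_on_mult:
  fixes f g :: "'a::euclidean_space \<Rightarrow> real"
  assumes "open S" "Ck_on k f S" "Ck_on k g S"
  shows "Ck_on k (\<lambda>p. f p * g p) S"
  using assms(2,3)
proof (induction k arbitrary: f g)
  case 0
  then show ?case by (simp add: continuous_on_mult)
next
  case (Suc k)
  show ?case
  proof (rule Ck_on_SucI[OF assms(1)])
    show "((\<lambda>p. f p * g p) has_derivative
        (\<lambda>v. f p * frechet_derivative g (at p) v + frechet_derivative f (at p) v * g p)) (at p)"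
      if "p \<in> S" for p
      using that Suc.prems assms(1) by (intro has_derivative_mult Ck_on_Suc_has_derivative)
    show "Ck_on k (\<lambda>p. f p * frechet_derivative g (at p) v
        + frechet_derivative f (at p) v * g p) S" for v
    proof (intro Ck_on_add[OF assms(1)] Suc.IH)
      show "Ck_on k f S" "Ck_on k g S"
        by (intro Suc.prems[THEN Ck_on_Suc_imp])+
    qed (use Suc.prems in auto)
  qed
qed

lemma Ck_on_linear_comp:
  assumes "open S" "bounded_linear l" "Ck_on k g S"
  shows "Ck_on k (\<lambda>p. l (g p)) S"
  using assms(3)
proof (induction k arbitrary: g)
  case 0
  then show ?case by (simp add: bounded_linear.continuous_on[OF assms(2)])
next
  case (Suc k)
  show ?case
  proof (rule Ck_on_SucI[OF assms(1)])
    show "((\<lambda>p. l (g p)) has_derivative (\<lambda>v. l (frechet_derivative g (at p) v))) (at p)"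
      if "p \<in> S" for p
      using that Suc.prems assms(1)
      by (intro bounded_linear.has_derivative[OF assms(2)] Ck_on_Suc_has_derivative)
  qed (use Suc in auto)
qed

lemma has_derivative_comp_linear:
  assumes "bounded_linear h" "(g has_derivative g') (at (h p))"
  shows "((\<lambda>p. g (h p)) has_derivative (\<lambda>v. g' (h v))) (at p)"
  using has_derivative_compose[OF bounded_linear_imp_has_derivative[OF assms(1)] assms(2)]
  by simp

text \<open>
  Precomposition with a linear map is the only change of variables that is needed, since all
  projections between the jet spaces and the covering are linear in coordinates. The derivative
  of \<open>g \<circ> h\<close> along \<open>v\<close> is then the derivative of \<open>g\<close> along the constant vector \<open>h v\<close>, again a
  function composed with \<open>h\<close>, so the induction needs no product rule.
\<close>

lemma Ck_on_comp_linear: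
  assumes "open S" "open T" "bounded_linear h" "h ` S \<subseteq> T" "Ck_on k g T"
  shows "Ck_on k (\<lambda>p. g (h p)) S"
  using assms(5)
proof (induction k arbitrary: g)
  case 0
  have "continuous_on S h"
    using assms(3) by (rule linear_continuous_on)
  then show ?case
    using 0 assms(4) by (auto intro: continuous_on_compose2)
next
  case (Suc k)
  show ?case
  proof (rule Ck_on_SucI[OF assms(1)])
    show "((\<lambda>p. g (h p)) has_derivative (\<lambda>v. frechet_derivative g (at (h p)) (h v))) (at p)"
      if "p \<in> S" for p
      using that Suc.prems assms
      by (auto intro!: has_derivative_comp_linear[OF assms(3)] simp del: Ck_on.simps
          intro: Ck_on_Suc_has_derivative)
  qed (use Suc in auto)
qed

lemma Ck_on_exp_linear:
  fixes l :: "'a::euclidean_space \<Rightarrow> real"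
  assumes "open S" "bounded_linear l"
  shows "Ck_on k (\<lambda>p. exp (l p)) S"
proof (induction k)
  case 0
  have "continuous_on S l"
    using assms(2) by (rule linear_continuous_on)
  then show ?case by (simp add: continuous_on_exp)
next
  case (Suc k)
  show ?case
  proof (rule Ck_on_SucI[OF assms(1)])
    show "((\<lambda>p. exp (l p)) has_derivative (\<lambda>v. exp (l p) * l v)) (at p)" for p
      using has_derivative_exp[OF bounded_linear_imp_has_derivative[OF assms(2)]]
      by (simp add: mult.commute)
    show "Ck_on k (\<lambda>p. exp (l p) * l v) S" for v
      using Suc assms(1) by (intro Ck_on_mult Ck_on_const)
  qed
qed

lemma smooth_on_cong:
  "open S \<Longrightarrow> (\<And>p. p \<in> S \<Longrightarrow> f p = g p) \<Longrightarrow> smooth_on S f \<longleftrightarrow> smooth_on S g"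
  unfolding smooth_on_def using Ck_on_cong by metis

lemma smooth_on_const: "open S \<Longrightarrow> smooth_on S (\<lambda>p. c)"
  unfolding smooth_on_def using Ck_on_const by blast

lemma smooth_on_add:
  "open S \<Longrightarrow> smooth_on S f \<Longrightarrow> smooth_on S g \<Longrightarrow> smooth_on S (\<lambda>p. f p + g p)"
  unfolding smooth_on_def using Ck_on_add by blast

lemma smooth_on_mult:
  fixes f g :: "'a::euclidean_space \<Rightarrow> real"
  shows "open S \<Longrightarrow> smooth_on S f \<Longrightarrow> smooth_on S g \<Longrightarrow> smooth_on S (\<lambda>p. f p * g p)"
  unfolding smooth_on_def using Ck_on_mult by blast

lemma smooth_on_linear_comp:
  "open S \<Longrightarrow> bounded_linear l \<Longrightarrow> smooth_on S g \<Longrightarrow> smooth_on S (\<lambda>p. l (g p))"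
  unfolding smooth_on_def using Ck_on_linear_comp by blast

lemma smooth_on_comp_linear:
  "open S \<Longrightarrow> open T \<Longrightarrow> bounded_linear h \<Longrightarrow> h ` S \<subseteq> T \<Longrightarrow> smooth_on T g
    \<Longrightarrow> smooth_on S (\<lambda>p. g (h p))"
  unfolding smooth_on_def using Ck_on_comp_linear by blast

lemma smooth_on_linear:
  fixes l :: "'a::euclidean_space \<Rightarrow> 'b::real_normed_vector"
  assumes "open S" "bounded_linear l"
  shows "smooth_on S l"
proof -
  have "Ck_on k l S" for k
  proof (cases k)
    case 0
    then show ?thesis using assms(2) by (simp add: linear_continuous_on)
  next
    case (Suc n)
    show ?thesis unfolding Suc
      using assms
      by (intro Ck_on_SucI[where g' = "\<lambda>_. l"])
         (simp_all add: bounded_linear_imp_has_derivative Ck_on_const)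
  qed
  then show ?thesis by (simp add: smooth_on_def)
qed

lemma smooth_on_exp_linear:
  fixes l :: "'a::euclidean_space \<Rightarrow> real"
  shows "open S \<Longrightarrow> bounded_linear l \<Longrightarrow> smooth_on S (\<lambda>p. exp (l p))"
  unfolding smooth_on_def using Ck_on_exp_linear by blast

lemma smooth_on_diff:
  fixes f g :: "'a::euclidean_space \<Rightarrow> 'b::real_normed_vector"
  assumes "open S" "smooth_on S f" "smooth_on S g"
  shows "smooth_on S (\<lambda>p. f p - g p)"
  using smooth_on_add[OF assms(1,2) smooth_on_linear_comp[OF assms(1) _ assms(3), of uminus]]
  by (simp add: bounded_linear_minus bounded_linear_ident)

lemma smooth_on_sum:
  assumes "open S" "\<And>i. i \<in> A \<Longrightarrow> smooth_on S (f i)"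
  shows "smooth_on S (\<lambda>p. \<Sum>i\<in>A. f i p)"
  using assms(2)
  by (induction A rule: infinite_finite_induct)
     (simp_all add: smooth_on_const smooth_on_add assms(1))

lemma smooth_on_directional_derivative:
  "smooth_on S g \<Longrightarrow> smooth_on S (\<lambda>p. frechet_derivative g (at p) v)"
  unfolding smooth_on_def using Ck_on.simps(2) by blast

lemma smooth_on_has_derivative:
  "smooth_on S g \<Longrightarrow> open S \<Longrightarrow> p \<in> S
    \<Longrightarrow> (g has_derivative frechet_derivative g (at p)) (at p)"
  unfolding smooth_on_def using Ck_on_Suc_has_derivative by blast


section \<open>Jet coordinates\<close>

lemmas bounded_linear_snd_snd = bounded_linear_compose[OF bounded_linear_snd bounded_linear_snd]

lemmas bounded_linear_fst_snd = bounded_linear_compose[OF bounded_linear_fst bounded_linear_snd]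

lemma bounded_linear_jet1_to_jet0: "bounded_linear (jet1_to_jet0 :: 'q::finite jet1 \<Rightarrow> _)"
  unfolding jet1_to_jet0_def case_prod_unfold
  by (intro bounded_linear_Pair bounded_linear_fst bounded_linear_fst_snd)

lemma bounded_linear_cov_to_jet1: "bounded_linear (cov_to_jet1 :: 'q::finite cov \<Rightarrow> _)"
  unfolding cov_to_jet1_def case_prod_unfold
  by (intro bounded_linear_Pair bounded_linear_fst bounded_linear_fst_snd
      bounded_linear_compose[OF bounded_linear_fst bounded_linear_snd_snd])

lemma bounded_linear_cov_w: "bounded_linear (cov_w :: 'q::finite cov \<Rightarrow> _)"
  unfolding cov_w_def case_prod_unfold
  by (rule bounded_linear_compose[OF bounded_linear_snd bounded_linear_snd_snd])

lemma J1_eq_vimage: "J1 M = jet1_to_jet0 -` M"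
  by (auto simp: J1_def jet1_to_jet0_def)

lemma Cov_eq_vimage: "Cov M = cov_to_jet1 -` J1 M"
  by (auto simp: J1_def Cov_def cov_to_jet1_def)

lemma open_J1: "open M \<Longrightarrow> open (J1 M)"
  unfolding J1_eq_vimage
  by (intro open_vimage linear_continuous_on bounded_linear_jet1_to_jet0)

lemma open_Cov: "open M \<Longrightarrow> open (Cov M)"
  unfolding Cov_eq_vimage
  by (intro open_vimage open_J1 linear_continuous_on bounded_linear_cov_to_jet1)

lemma bounded_linear_jet1_coordinate: "bounded_linear (\<lambda>p :: 'q::finite jet1. snd (snd p) $ a)"
  by (rule bounded_linear_compose[OF bounded_linear_vec_nth bounded_linear_snd_snd])

lemma jet1_derivative_decompose:
  fixes g' :: "'q::finite jet1 \<Rightarrow> real"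
  assumes "bounded_linear g'"
  shows "g' (s, v, v1) = s * g' (1, 0, 0)
    + (\<Sum>a\<in>UNIV. v $ a * g' (0, axis a 1, 0)) + (\<Sum>a\<in>UNIV. v1 $ a * g' (0, 0, axis a 1))"
proof -
  interpret bounded_linear g' by fact
  have "(s, v, v1) = s *\<^sub>R (1, 0, 0)
      + (\<Sum>a\<in>UNIV. v $ a *\<^sub>R (0, axis a 1, 0)) + (\<Sum>a\<in>UNIV. v1 $ a *\<^sub>R (0, 0, axis a 1))"
    (is "_ = ?rhs")
  proof (intro prod_eqI)
    show "fst (s, v, v1) = fst ?rhs" by (simp add: fst_sum)
    show "fst (snd (s, v, v1)) = fst (snd ?rhs)"
      using basis_expansion[of v] by (simp add: fst_sum snd_sum scalar_mult_eq_scaleR)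
    show "snd (snd (s, v, v1)) = snd (snd ?rhs)"
      using basis_expansion[of v1] by (simp add: fst_sum snd_sum scalar_mult_eq_scaleR)
  qed
  then have "g' (s, v, v1) = g' ?rhs" by (rule arg_cong)
  also have "\<dots> = s * g' (1, 0, 0)
    + (\<Sum>a\<in>UNIV. v $ a * g' (0, axis a 1, 0)) + (\<Sum>a\<in>UNIV. v1 $ a * g' (0, 0, axis a 1))"
    unfolding add sum scaleR by simp
  finally show ?thesis .
qed


section \<open>The Noether identity for lambda-prolongations\<close>

text \<open>
  This is the function \<open>I = X \<lrcorner> \<Theta> - R\<close> with the \<open>u1\<close>-component of \<open>X\<close> left out: \<open>\<Theta>\<close> has no
  \<open>du1\<close> part, so \<open>I\<close> depends on the vector field \<open>X0\<close> on the total space and not on \<open>lam\<close>.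
\<close>

definition noether_current ::
    "('q::finite jet1 \<Rightarrow> real) \<Rightarrow> ('q jet0 \<Rightarrow> 'q jet0) \<Rightarrow> ('q jet0 \<Rightarrow> real) \<Rightarrow> 'q jet1 \<Rightarrow> real" where
  "noether_current L X0 R p =
     (\<Sum>a\<in>UNIV. d_u1 a L p * (snd (X0 (jet1_to_jet0 p)) $ a
        - snd (snd p) $ a * fst (X0 (jet1_to_jet0 p))))
     + L p * fst (X0 (jet1_to_jet0 p)) - R (jet1_to_jet0 p)"

lemma contract_lambda_prolongation:
  "contract (lambda_prolongation lam X0) (poincare_cartan L) p - R (jet1_to_jet0 p)
    = noether_current L X0 R p"
  by (cases p)
     (simp add: contract_def lambda_prolongation_def poincare_cartan_def noether_current_def
        jet1_to_jet0_def Let_def)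

lemma smooth_on_d_u1: "smooth_on S L \<Longrightarrow> smooth_on S (d_u1 a L)"
  unfolding d_u1_def[abs_def] by (rule smooth_on_directional_derivative)

lemma smooth_on_fst: "open S \<Longrightarrow> smooth_on S g \<Longrightarrow> smooth_on S (\<lambda>p. fst (g p))"
  by (rule smooth_on_linear_comp[OF _ bounded_linear_fst])

lemma smooth_on_snd_nth: "open S \<Longrightarrow> smooth_on S g \<Longrightarrow> smooth_on S (\<lambda>p. snd (g p) $ a)"
  by (rule smooth_on_linear_comp
        [OF _ bounded_linear_compose[OF bounded_linear_vec_nth bounded_linear_snd]])

lemma smooth_on_noether_current:
  assumes "open M" "smooth_on (J1 M) L" "smooth_on M X0" "smooth_on M R"
  shows "smooth_on (J1 M) (noether_current L X0 R)"
proof -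
  have pull: "smooth_on (J1 M) (\<lambda>p. g (jet1_to_jet0 p))" if "smooth_on M g"
    for g :: "'a jet0 \<Rightarrow> real"
    using that assms(1)
    by (intro smooth_on_comp_linear[OF open_J1 _ bounded_linear_jet1_to_jet0])
       (auto simp: J1_eq_vimage)
  show ?thesis
    unfolding noether_current_def[abs_def]
    using assms
    by (intro smooth_on_diff smooth_on_add smooth_on_sum smooth_on_mult open_J1 smooth_on_d_u1
        smooth_on_linear[OF _ bounded_linear_jet1_coordinate]
        pull smooth_on_fst smooth_on_snd_nth)
qed

lemma has_derivative_jet0_pullback:
  assumes "open M" "smooth_on M g" "p \<in> J1 M"
  shows "((\<lambda>p. g (jet1_to_jet0 p)) has_derivative
           (\<lambda>v. frechet_derivative g (at (jet1_to_jet0 p)) (jet1_to_jet0 v))) (at p)"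
  using assms
  by (intro has_derivative_comp_linear[OF bounded_linear_jet1_to_jet0] smooth_on_has_derivative)
     (auto simp: J1_eq_vimage)

text \<open>
  The expansion of \<open>D_x I\<close> has \<open>D_x (L_{u1^a})\<close> in it, which is \<open>L_{u^a} - E_a(L)\<close>. The terms
  \<open>u2^a L_{u1^a} \<xi>\<close> coming from \<open>D_x Q^a\<close> and from \<open>D_x L\<close> cancel, which leaves the ordinary
  prolongation of \<open>X0\<close> applied to \<open>L\<close>. The factor \<open>lam\<close> does not occur in \<open>D_x I\<close>; its terms in
  the bracket add up to \<open>lam I\<close>, which the last term cancels.
\<close>

lemma lambda_noether_identity:
  fixes M :: "'q::finite jet0 set" and u1 :: "real ^ 'q"
  assumes "open M" "smooth_on (J1 M) L" "smooth_on M X0" "smooth_on M R" "(x, u) \<in> M"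
  defines "p \<equiv> (x, u, u1)"
  shows "Dx1 (noether_current L X0 R) (x, u, u1, u2) =
      - (\<Sum>a\<in>UNIV. euler_lagrange L a (x, u, u1, u2)
           * (snd (X0 (x, u)) $ a - u1 $ a * fst (X0 (x, u))))
      + (vf_apply (lambda_prolongation lam X0) L p + L p * Dx_plus lam (\<lambda>m. fst (X0 m)) p
           - Dx_plus lam R p)
      - lam p * noether_current L X0 R p"
proof -
  let ?V = "(1, u1, u2) :: 'q jet1"
  define \<xi> where "\<xi> = (\<lambda>m. fst (X0 m))"
  define \<eta> where "\<eta> = (\<lambda>a m. snd (X0 m) $ a)"
  define L' where "L' = frechet_derivative L (at p)"
  define Q where "Q = (\<lambda>a. \<eta> a (x, u) - u1 $ a * \<xi> (x, u))"
  have p: "p \<in> J1 M" and base: "jet1_to_jet0 p = (x, u)"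
    and coord: "snd (snd p) = u1" "jet1_to_jet0 ?V = (1, u1)"
    using assms(5) by (simp_all add: p_def J1_def jet1_to_jet0_def)
  have \<xi>: "smooth_on M \<xi>" and \<eta>: "smooth_on M (\<eta> a)" for a
    unfolding \<xi>_def \<eta>_def
    using assms(1,3) by (auto intro: smooth_on_fst smooth_on_snd_nth)
  have L: "(L has_derivative L') (at p)"
    unfolding L'_def using p by (rule smooth_on_has_derivative[OF assms(2) open_J1[OF assms(1)]])
  have L_u1: "(d_u1 a L has_derivative frechet_derivative (d_u1 a L) (at p)) (at p)" for a
    using p by (rule smooth_on_has_derivative[OF smooth_on_d_u1[OF assms(2)] open_J1[OF assms(1)]])
  note coord_derivative =
    bounded_linear_imp_has_derivative[OF bounded_linear_jet1_coordinate, of _ "at p"]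
  note pull = has_derivative_jet0_pullback[OF assms(1) _ p, unfolded base]
  have current: "noether_current L X0 R = (\<lambda>p.
      (\<Sum>a\<in>UNIV. d_u1 a L p * (\<eta> a (jet1_to_jet0 p) - snd (snd p) $ a * \<xi> (jet1_to_jet0 p)))
      + L p * \<xi> (jet1_to_jet0 p) - R (jet1_to_jet0 p))"
    by (simp add: noether_current_def[abs_def] \<xi>_def \<eta>_def)
  have current_p: "noether_current L X0 R p
      = (\<Sum>a\<in>UNIV. d_u1 a L p * Q a) + L p * \<xi> (x, u) - R (x, u)"
    by (simp add: current base coord Q_def)
  define q where "q = (\<lambda>a p. \<eta> a (jet1_to_jet0 p) - snd (snd p) $ a * \<xi> (jet1_to_jet0 p))"
  define q' where "q' = (\<lambda>a v. frechet_derivative (\<eta> a) (at (x, u)) (jet1_to_jet0 v)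
      - (u1 $ a * frechet_derivative \<xi> (at (x, u)) (jet1_to_jet0 v)
        + snd (snd v) $ a * \<xi> (x, u)))"
  have q_p: "q a p = Q a" for a
    by (simp add: q_def Q_def base coord)
  have q_derivative: "(q a has_derivative q' a) (at p)" for a
    using has_derivative_diff[OF pull[OF \<eta>] has_derivative_mult[OF coord_derivative pull[OF \<xi>]],
        of a a]
    unfolding q_def q'_def base coord .
  have "((\<lambda>p. \<Sum>a\<in>UNIV. d_u1 a L p * q a p) has_derivative
      (\<lambda>v. \<Sum>a\<in>UNIV. d_u1 a L p * q' a v + frechet_derivative (d_u1 a L) (at p) v * q a p)) (at p)"
    by (intro has_derivative_sum has_derivative_mult L_u1 q_derivative)
  from has_derivative_diff[OF has_derivative_add[OF this has_derivative_mult[OF L pull[OF \<xi>]]]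
      pull[OF assms(4)]]
  have "(noether_current L X0 R has_derivative (\<lambda>v.
      (\<Sum>a\<in>UNIV. d_u1 a L p * q' a v + frechet_derivative (d_u1 a L) (at p) v * Q a)
      + (L p * frechet_derivative \<xi> (at (x, u)) (jet1_to_jet0 v) + L' v * \<xi> (x, u))
      - frechet_derivative R (at (x, u)) (jet1_to_jet0 v))) (at p)"
    unfolding current q_p base unfolding q_def .
  from frechet_derivative_eqI[OF this]
  have "Dx1 (noether_current L X0 R) (x, u, u1, u2) =
      (\<Sum>a\<in>UNIV. d_u1 a L p * (Dx0 (\<eta> a) p - (u1 $ a * Dx0 \<xi> p + u2 $ a * \<xi> (x, u)))
        + Dx1 (d_u1 a L) (x, u, u1, u2) * Q a)
      + (L p * Dx0 \<xi> p + L' ?V * \<xi> (x, u)) - Dx0 R p"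
    by (simp add: Dx1_def Dx0_def p_def q'_def coord)
  \<comment> \<open>Substitute \<open>D_x (L_{u1^a}) = L_{u^a} - E_a(L)\<close>, and add and subtract
    \<open>lam L_{u1^a} Q^a\<close> to complete the \<open>u1\<close>-component of the prolongation.\<close>
  also have "\<dots> = (\<Sum>a\<in>UNIV.
        - (euler_lagrange L a (x, u, u1, u2) * Q a)
        + (\<eta> a (x, u) * d_u a L p + (Dx0 (\<eta> a) p - Dx0 \<xi> p * u1 $ a + lam p * Q a) * d_u1 a L p)
        - \<xi> (x, u) * (u1 $ a * d_u a L p + u2 $ a * d_u1 a L p)
        - lam p * (d_u1 a L p * Q a))
      + (L p * Dx0 \<xi> p + L' ?V * \<xi> (x, u)) - Dx0 R p"
  proof -
    have "Dx1 (d_u1 a L) (x, u, u1, u2) = d_u a L p - euler_lagrange L a (x, u, u1, u2)" for a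
      by (simp add: euler_lagrange_def p_def)
    then show ?thesis
      unfolding Q_def by (simp only:, simp add: algebra_simps)
  qed
  also have "\<dots> = - (\<Sum>a\<in>UNIV. euler_lagrange L a (x, u, u1, u2) * Q a)
      + (\<Sum>a\<in>UNIV. \<eta> a (x, u) * d_u a L p
          + (Dx0 (\<eta> a) p - Dx0 \<xi> p * u1 $ a + lam p * Q a) * d_u1 a L p)
      - \<xi> (x, u) * (\<Sum>a\<in>UNIV. u1 $ a * d_u a L p + u2 $ a * d_u1 a L p)
      - lam p * (\<Sum>a\<in>UNIV. d_u1 a L p * Q a)
      + (L p * Dx0 \<xi> p + L' ?V * \<xi> (x, u)) - Dx0 R p"
    by (simp only: sum_subtractf sum.distrib sum_negf sum_distrib_left[symmetric])
  finally have D: "Dx1 (noether_current L X0 R) (x, u, u1, u2) = \<dots>" .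
  have L'_coord: "L' (s, v, v1) = s * L' (1, 0, 0)
      + (\<Sum>a\<in>UNIV. v $ a * d_u a L p + v1 $ a * d_u1 a L p)" for s v v1
    unfolding d_u_def d_u1_def L'_def[symmetric] sum.distrib add.assoc[symmetric]
    using L by (intro jet1_derivative_decompose has_derivative_bounded_linear)
  have "vf_apply (lambda_prolongation lam X0) L p
      = L' (\<xi> (x, u), \<chi> a. \<eta> a (x, u),
          \<chi> a. Dx0 (\<eta> a) p - Dx0 \<xi> p * u1 $ a + lam p * (\<eta> a (x, u) - \<xi> (x, u) * u1 $ a))"
    by (simp add: vf_apply_def lambda_prolongation_def L'_def \<xi>_def \<eta>_def p_def Let_def)
  also have "\<dots> = \<xi> (x, u) * L' (1, 0, 0) + (\<Sum>a\<in>UNIV. \<eta> a (x, u) * d_u a L p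
          + (Dx0 (\<eta> a) p - Dx0 \<xi> p * u1 $ a + lam p * Q a) * d_u1 a L p)"
    by (subst L'_coord) (simp add: Q_def mult.commute)
  finally have XL: "vf_apply (lambda_prolongation lam X0) L p = \<dots>" .
  have Q: "Q a = snd (X0 (x, u)) $ a - u1 $ a * fst (X0 (x, u))" for a
    by (simp add: Q_def \<xi>_def \<eta>_def)
  show ?thesis
    unfolding D XL current_p Dx_plus_def base \<xi>_def[symmetric] Q[symmetric] L'_coord[of 1 u1 u2]
    by (simp add: algebra_simps)
qed


section \<open>The first integral on the covering\<close>

text \<open>
  The pullback of \<open>\<Theta>\<close> sees a tangent vector only through its projection to the first jet space,
  which removes the \<open>\<partial>_w\<close> component, and \<open>\<Theta>\<close> is linear over the factor \<open>e^w\<close>.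
\<close>

lemma contract_cov_lift_pullback:
  "contract (cov_lift X A) (form_pullback cov_to_jet1 (poincare_cartan L)) p
    = exp (cov_w p) * contract X (poincare_cartan L) (cov_to_jet1 p)"
proof -
  have "frechet_derivative cov_to_jet1 (at p) = cov_to_jet1"
    by (intro frechet_derivative_eqI bounded_linear_imp_has_derivative bounded_linear_cov_to_jet1)
  then show ?thesis
    by (cases p)
       (simp add: contract_def form_pullback_def cov_lift_def cov_to_jet1_def poincare_cartan_def
          sum_distrib_left algebra_simps sum_subtractf split: prod.splits)
qed

text \<open>
  The covering derivative of \<open>w\<close> is \<open>lam\<close>, so \<open>e^w\<close> is an integrating factor for \<open>D F = - lam F\<close>:
  the derivative of \<open>e^w F\<close> is \<open>e^w (D F + lam F)\<close>.
\<close>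

lemma cov_first_integral_exp_w:
  assumes "open M" "smooth_on (J1 M) F"
    and D: "\<And>x u u1. (x, u) \<in> M \<Longrightarrow>
      Dx1 F (x, u, u1, f (x, u, u1)) = - lam (x, u, u1) * F (x, u, u1)"
  shows "cov_first_integral M f lam (\<lambda>p. exp (cov_w p) * F (cov_to_jet1 p))"
  unfolding cov_first_integral_def
proof (intro conjI ballI)
  show "smooth_on (Cov M) (\<lambda>p. exp (cov_w p) * F (cov_to_jet1 p))"
    using assms(1,2)
    by (intro smooth_on_mult smooth_on_exp_linear bounded_linear_cov_w open_Cov
        smooth_on_comp_linear[OF _ open_J1 bounded_linear_cov_to_jet1])
       (auto simp: Cov_eq_vimage)
next
  fix p :: "'a cov" assume p: "p \<in> Cov M"
  obtain x u u1 w where p_eq: "p = (x, u, u1, w)" by (metis prod_cases4)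
  let ?V = "cov_total_derivative f lam p"
  have mem: "(x, u) \<in> M" using p by (simp add: p_eq Cov_def)
  have "(F has_derivative frechet_derivative F (at (cov_to_jet1 p))) (at (cov_to_jet1 p))"
    using p by (intro smooth_on_has_derivative[OF assms(2) open_J1[OF assms(1)]])
      (simp add: Cov_eq_vimage)
  from has_derivative_mult[OF
      has_derivative_exp[OF bounded_linear_imp_has_derivative[OF bounded_linear_cov_w]]
      has_derivative_comp_linear[OF bounded_linear_cov_to_jet1 this]]
  have "vf_apply (cov_total_derivative f lam) (\<lambda>p. exp (cov_w p) * F (cov_to_jet1 p)) p
      = exp (cov_w p) * frechet_derivative F (at (cov_to_jet1 p)) (cov_to_jet1 ?V)
        + exp (cov_w p) * cov_w ?V * F (cov_to_jet1 p)"
    unfolding vf_apply_def by (subst frechet_derivative_eqI) (auto simp: mult_ac)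
  also have "\<dots> = exp w * (Dx1 F (x, u, u1, f (x, u, u1)) + lam (x, u, u1) * F (x, u, u1))"
    by (simp add: p_eq cov_w_def cov_to_jet1_def cov_total_derivative_def Dx1_def algebra_simps)
  also have "\<dots> = 0" using D[OF mem] by simp
  finally show "vf_apply (cov_total_derivative f lam)
      (\<lambda>p. exp (cov_w p) * F (cov_to_jet1 p)) p = 0" .
qed

text \<open>
  The vector field of a \<open>lam\<close>-symmetry is known to be a prolongation only over \<open>M\<close>, so the
  contraction with \<open>\<Theta>\<close> and the explicit current agree only there; openness of the covering
  domain carries the derivatives over.
\<close>

lemma cov_first_integral_cong:
  assumes "open M" "cov_first_integral M f lam F" "\<And>p. p \<in> Cov M \<Longrightarrow> F p = G p"
  shows "cov_first_integral M f lam G"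
proof -
  have "smooth_on (Cov M) G"
    using assms smooth_on_cong[OF open_Cov[OF assms(1)]]
    unfolding cov_first_integral_def by blast
  moreover have "frechet_derivative G (at p) = frechet_derivative F (at p)" if "p \<in> Cov M" for p
  proof (rule frechet_derivative_eqI)
    have "(F has_derivative frechet_derivative F (at p)) (at p)"
      using assms(1,2) that unfolding cov_first_integral_def
      by (blast intro: smooth_on_has_derivative open_Cov)
    then show "(G has_derivative frechet_derivative F (at p)) (at p)"
      using open_Cov[OF assms(1)] that assms(3) by (rule has_derivative_transform_within_open)
  qed
  ultimately show ?thesis
    using assms(2) by (simp add: cov_first_integral_def vf_apply_def)
qed

theorem proposition3:
  fixes M :: "(real \<times> (real ^ 'q::finite)) set"
    and L lam :: "'q jet1 \<Rightarrow> real"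
    and f :: "'q jet1 \<Rightarrow> real ^ 'q"
    and X :: "'q jet1 \<Rightarrow> 'q jet1"
    and R :: "'q jet0 \<Rightarrow> real"
    and A :: "'q cov \<Rightarrow> real"
  assumes "open M"
    and "regular_lagrangian M L"
    and "euler_lagrange_solved_form M L f"
    and "smooth_on (J1 M) lam"
    and "lambda_variational_symmetry M L lam X R"
    and "smooth_on (Cov M) A"
  shows "let \<Theta> = poincare_cartan L;
             I = (\<lambda>p. contract X \<Theta> p - R (jet1_to_jet0 p));
             I' = (\<lambda>p. contract (cov_lift X A) (form_pullback cov_to_jet1 \<Theta>) p
                       - exp (cov_w p) * R (jet1_to_jet0 (cov_to_jet1 p)))
         in (\<forall>p\<in>Cov M. I' p = exp (cov_w p) * I (cov_to_jet1 p)) \<and>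
            cov_first_integral M f lam I'"
proof -
  obtain X0 where X0: "smooth_on M X0"
    and prolong: "\<And>p. p \<in> J1 M \<Longrightarrow> X p = lambda_prolongation lam X0 p"
    and symmetry: "\<And>p. p \<in> J1 M \<Longrightarrow>
      vf_apply X L p + L p * Dx_plus lam (\<lambda>m. fst (X0 m)) p = Dx_plus lam R p"
    and R: "smooth_on M R"
    using assms(5) unfolding lambda_variational_symmetry_def by blast
  have L: "smooth_on (J1 M) L"
    using assms(2) by (simp add: regular_lagrangian_def)
  let ?I = "noether_current L X0 R"
  have I: "contract X (poincare_cartan L) p - R (jet1_to_jet0 p) = ?I p" if "p \<in> J1 M" for p
    using prolong[OF that] contract_lambda_prolongation[of lam X0 L p R]
    by (simp add: contract_def)
  have "Dx1 ?I (x, u, u1, f (x, u, u1)) = - lam (x, u, u1) * ?I (x, u, u1)"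
    if "(x, u) \<in> M" for x u u1
  proof -
    let ?p = "(x, u, u1)"
    have p: "?p \<in> J1 M" using that by (simp add: J1_def)
    have "euler_lagrange L a (x, u, u1, f ?p) = 0" for a
      using assms(3) that unfolding euler_lagrange_solved_form_def by blast
    moreover have "vf_apply (lambda_prolongation lam X0) L ?p
        + L ?p * Dx_plus lam (\<lambda>m. fst (X0 m)) ?p = Dx_plus lam R ?p"
      using symmetry[OF p] prolong[OF p] by (simp add: vf_apply_def)
    ultimately show ?thesis
      using lambda_noether_identity[OF assms(1) L X0 R that, of u1 "f ?p" lam] by simp
  qed
  from cov_first_integral_exp_w[OF assms(1) smooth_on_noether_current[OF assms(1) L X0 R] this]
  have "cov_first_integral M f lam (\<lambda>p. exp (cov_w p) * ?I (cov_to_jet1 p))" .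
  moreover have "exp (cov_w p) * ?I (cov_to_jet1 p)
      = contract (cov_lift X A) (form_pullback cov_to_jet1 (poincare_cartan L)) p
        - exp (cov_w p) * R (jet1_to_jet0 (cov_to_jet1 p))" if "p \<in> Cov M" for p
  proof -
    have "cov_to_jet1 p \<in> J1 M" using that by (simp add: Cov_eq_vimage)
    then show ?thesis
      by (simp add: I[symmetric] contract_cov_lift_pullback right_diff_distrib)
  qed
  ultimately have "cov_first_integral M f lam
      (\<lambda>p. contract (cov_lift X A) (form_pullback cov_to_jet1 (poincare_cartan L)) p
        - exp (cov_w p) * R (jet1_to_jet0 (cov_to_jet1 p)))"
    by (rule cov_first_integral_cong[OF assms(1)])
  then show ?thesis
    by (simp add: Let_def contract_cov_lift_pullback algebra_simps)
qed

end
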